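(* The second-order EOP-SAV/CN scheme described in the context is unconditionally energy stable: for every $\Delta t>0$ and every $n\ge0$, $$\widetilde{\mathcal E}(\phi^{n+1})-\widetilde{\mathcal E}(\phi^{n})\le 0,\qquad\text{where } \widetilde{\mathcal E}(\phi^{m})=\tfrac12(\mathcal L\phi^{m},\phi^{m})+|R^{m}|^2-C .$$ Moreover, if $s^{n+1}\ge\sqrt{\mathcal E_1(\phi^{n+1})}$, then the original dissipative law holds: $$\mathcal E(\phi^{n+1})\le\mathcal E(\phi^{n}),\qquad\text{where } \mathcal E(\phi^{m})=\tfrac12(\mathcal L\phi^{m},\phi^{m})+E_1(\phi^{m})$$ is the original energy.
   Context: Setting: $\Omega$ is the spatial domain and $(\cdot,\cdot)$ is the $L^2(\Omega)$ inner product. The free energy is $E(\phi)=\frac12(\phi,\mathcal L\phi)+E_1(\phi)$ with $E_1(\phi)=\int_\Omega F(\phi)\,d\mathbf x$, where $\mathcal L$ is a symmetric non-negative linear operator and $F$ is a differentiable energy density with derivative $F'$. The gradient flow is $\partial_t\phi=-\mathcal G\mu$, $\mu=\mathcal L\phi+F'(\phi)$, with $\mathcal G$ a positive linear operator (so $(\mathcal G\mu,\mu)\ge0$). It is assumed that $E_1$ is bounded below: $E_1(\phi)>-C$ for all $\phi$, for a constant $C>0$. Put $\mathcal E_1(\phi)=E_1(\phi)+C>0$. EOP-SAV/CN scheme: set $\phi^0=\phi_0$, $R^0=\sqrt{E_1(\phi_0)+C}$ ($\phi^{-1}$ is a given starting value used only in the extrapolation at $n=0$). For $n\ge0$, with $\widehat\phi^{n+\frac12}=\frac32\phi^n-\frac12\phi^{n-1}$: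 Step I: $\phi^{n+1},\mu^{n+\frac12},\widetilde R^{n+1}$ (with $\widetilde R^{n+1}\in\mathbb R$) solve $$\frac{\phi^{n+1}-\phi^n}{\Delta t}=-\mathcal G\mu^{n+\frac12},$$ $$\mu^{n+\frac12}=\tfrac12\mathcal L\phi^{n+1}+\tfrac12\mathcal L\phi^n+\frac{\widetilde R^{n+1}+R^n}{2\sqrt{\mathcal E_1(\widehat\phi^{n+\frac12})}}F'(\widehat\phi^{n+\frac12}),$$ $$\frac{\widetilde R^{n+1}-R^n}{\Delta t}=\frac{1}{2\sqrt{\mathcal E_1(\widehat\phi^{n+\frac12})}}\left(F'(\widehat\phi^{n+\frac12}),\frac{\phi^{n+1}-\phi^n}{\Delta t}\right).$$ Step II: $R^{n+1}=\min\{s^{n+1},\sqrt{\mathcal E_1(\phi^{n+1})}\}$ with $s^{n+1}=\sqrt{\frac12(\mathcal L\phi^{n},\phi^{n})-\frac12(\mathcal L\phi^{n+1},\phi^{n+1})+|R^{n}|^2}$ (the radicand is non-negative for solutions of Step I). The functions $\phi^n,\mu^{n+\frac12}$ are assumed regular enough that all expressions make sense. *)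

theory Defs
  imports "HOL-Analysis.Analysis"
begin

(* Elements of L^2(Omega) are represented by functions on the ambient space; only their values on
   Omega matter, and equality of elements is equality almost everywhere on Omega. *)

definition L2_space :: "'a::euclidean_space set \<Rightarrow> ('a \<Rightarrow> real) set" where
  "L2_space \<Omega> = {u. u \<in> borel_measurable (lebesgue_on \<Omega>) \<and>
                     integrable (lebesgue_on \<Omega>) (\<lambda>x. (u x)\<^sup>2)}"

definition L2_inner :: "'a::euclidean_space set \<Rightarrow> ('a \<Rightarrow> real) \<Rightarrow> ('a \<Rightarrow> real) \<Rightarrow> real" where
  "L2_inner \<Omega> u v = integral\<^sup>L (lebesgue_on \<Omega>) (\<lambda>x. u x * v x)"

(* A possibly unbounded linear operator T in L^2(Omega) with domain D (differential operators are
   the intended examples).  The last clause says that T is well defined on classes modulo equality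
   almost everywhere. *)

definition linear_operator_L2 ::
  "'a::euclidean_space set \<Rightarrow> ('a \<Rightarrow> real) set \<Rightarrow> (('a \<Rightarrow> real) \<Rightarrow> 'a \<Rightarrow> real) \<Rightarrow> bool" where
  "linear_operator_L2 \<Omega> D T \<longleftrightarrow>
     D \<subseteq> L2_space \<Omega> \<and> (\<lambda>x. 0) \<in> D \<and>
     (\<forall>u\<in>D. \<forall>v\<in>D. (\<lambda>x. u x + v x) \<in> D) \<and>
     (\<forall>c. \<forall>u\<in>D. (\<lambda>x. c * u x) \<in> D) \<and>
     (\<forall>u\<in>D. T u \<in> L2_space \<Omega>) \<and>
     (\<forall>u\<in>D. \<forall>v\<in>D. AE x in lebesgue_on \<Omega>. T (\<lambda>y. u y + v y) x = T u x + T v x) \<and>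
     (\<forall>c. \<forall>u\<in>D. AE x in lebesgue_on \<Omega>. T (\<lambda>y. c * u y) x = c * T u x) \<and>
     (\<forall>u\<in>D. \<forall>v\<in>D. (AE x in lebesgue_on \<Omega>. u x = v x) \<longrightarrow>
                      (AE x in lebesgue_on \<Omega>. T u x = T v x))"

definition symmetric_L2 ::
  "'a::euclidean_space set \<Rightarrow> ('a \<Rightarrow> real) set \<Rightarrow> (('a \<Rightarrow> real) \<Rightarrow> 'a \<Rightarrow> real) \<Rightarrow> bool" where
  "symmetric_L2 \<Omega> D T \<longleftrightarrow> (\<forall>u\<in>D. \<forall>v\<in>D. L2_inner \<Omega> (T u) v = L2_inner \<Omega> u (T v))"

definition nonneg_L2 ::
  "'a::euclidean_space set \<Rightarrow> ('a \<Rightarrow> real) set \<Rightarrow> (('a \<Rightarrow> real) \<Rightarrow> 'a \<Rightarrow> real) \<Rightarrow> bool" where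
  "nonneg_L2 \<Omega> D T \<longleftrightarrow> (\<forall>u\<in>D. 0 \<le> L2_inner \<Omega> (T u) u)"

definition E1 :: "'a::euclidean_space set \<Rightarrow> (real \<Rightarrow> real) \<Rightarrow> ('a \<Rightarrow> real) \<Rightarrow> real" where
  "E1 \<Omega> F u = integral\<^sup>L (lebesgue_on \<Omega>) (\<lambda>x. F (u x))"

definition E1_shifted ::
  "'a::euclidean_space set \<Rightarrow> (real \<Rightarrow> real) \<Rightarrow> real \<Rightarrow> ('a \<Rightarrow> real) \<Rightarrow> real" where
  "E1_shifted \<Omega> F C u = E1 \<Omega> F u + C"

definition energy ::
  "'a::euclidean_space set \<Rightarrow> (('a \<Rightarrow> real) \<Rightarrow> 'a \<Rightarrow> real) \<Rightarrow> (real \<Rightarrow> real) \<Rightarrow> ('a \<Rightarrow> real) \<Rightarrow> real" where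
  "energy \<Omega> L F u = 1/2 * L2_inner \<Omega> (L u) u + E1 \<Omega> F u"

definition modified_energy ::
  "'a::euclidean_space set \<Rightarrow> (('a \<Rightarrow> real) \<Rightarrow> 'a \<Rightarrow> real) \<Rightarrow> real \<Rightarrow> ('a \<Rightarrow> real) \<Rightarrow> real \<Rightarrow> real" where
  "modified_energy \<Omega> L C u r = 1/2 * L2_inner \<Omega> (L u) u + \<bar>r\<bar>\<^sup>2 - C"

(* phi_hat prev phi n is the extrapolation at time level n + 1/2; prev plays the role of
   phi at time level -1. *)

definition phi_hat :: "('a \<Rightarrow> real) \<Rightarrow> (nat \<Rightarrow> 'a \<Rightarrow> real) \<Rightarrow> nat \<Rightarrow> 'a \<Rightarrow> real" where
  "phi_hat prev \<phi> n =
     (\<lambda>x. 3/2 * \<phi> n x - 1/2 * (case n of 0 \<Rightarrow> prev x | Suc m \<Rightarrow> \<phi> m x))"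

(* Half-integer levels are indexed by their lower neighbour: mu n is the chemical potential at
   level n + 1/2. *)

definition step_I ::
  "'a::euclidean_space set \<Rightarrow> (('a \<Rightarrow> real) \<Rightarrow> 'a \<Rightarrow> real) \<Rightarrow> (('a \<Rightarrow> real) \<Rightarrow> 'a \<Rightarrow> real) \<Rightarrow>
   (real \<Rightarrow> real) \<Rightarrow> (real \<Rightarrow> real) \<Rightarrow> real \<Rightarrow> real \<Rightarrow> ('a \<Rightarrow> real) \<Rightarrow> (nat \<Rightarrow> 'a \<Rightarrow> real) \<Rightarrow>
   (nat \<Rightarrow> 'a \<Rightarrow> real) \<Rightarrow> (nat \<Rightarrow> real) \<Rightarrow> (nat \<Rightarrow> real) \<Rightarrow> nat \<Rightarrow> bool" where
  "step_I \<Omega> L G F F' C dt prev \<phi> \<mu> Rt R n \<longleftrightarrow>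
     (let h = phi_hat prev \<phi> n; q = sqrt (E1_shifted \<Omega> F C h) in
       (AE x in lebesgue_on \<Omega>. (\<phi> (Suc n) x - \<phi> n x) / dt = - G (\<mu> n) x) \<and>
       (AE x in lebesgue_on \<Omega>.
          \<mu> n x = 1/2 * L (\<phi> (Suc n)) x + 1/2 * L (\<phi> n) x
                  + (Rt (Suc n) + R n) / (2 * q) * F' (h x)) \<and>
       (Rt (Suc n) - R n) / dt =
          1 / (2 * q) * L2_inner \<Omega> (\<lambda>x. F' (h x)) (\<lambda>x. (\<phi> (Suc n) x - \<phi> n x) / dt))"

definition step_II ::
  "'a::euclidean_space set \<Rightarrow> (('a \<Rightarrow> real) \<Rightarrow> 'a \<Rightarrow> real) \<Rightarrow> (real \<Rightarrow> real) \<Rightarrow> real \<Rightarrow>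
   (nat \<Rightarrow> 'a \<Rightarrow> real) \<Rightarrow> (nat \<Rightarrow> real) \<Rightarrow> (nat \<Rightarrow> real) \<Rightarrow> nat \<Rightarrow> bool" where
  "step_II \<Omega> L F C \<phi> R s n \<longleftrightarrow>
     s (Suc n) = sqrt (1/2 * L2_inner \<Omega> (L (\<phi> n)) (\<phi> n)
                       - 1/2 * L2_inner \<Omega> (L (\<phi> (Suc n))) (\<phi> (Suc n)) + \<bar>R n\<bar>\<^sup>2) \<and>
     R (Suc n) = min (s (Suc n)) (sqrt (E1_shifted \<Omega> F C (\<phi> (Suc n))))"

end

theory Submission
  imports Defs
begin

text \<open>
  Testing the first equation of Step I with \<open>\<mu>\<close> at level \<open>n + 1/2\<close> and the second one with
  \<open>\<phi> (Suc n) - \<phi> n\<close> makes the nonlinear contribution telescope to \<open>(Rt (Suc n))\<^sup>2 - (R n)\<^sup>2\<close> by the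
  third equation, and the contribution of \<open>L\<close> telescopes by symmetry. Hence
  \<open>1/2 (L \<phi> (Suc n), \<phi> (Suc n)) + (Rt (Suc n))\<^sup>2 \<le> 1/2 (L \<phi> n, \<phi> n) + (R n)\<^sup>2\<close>,
  which says that the radicand of \<open>s (Suc n)\<close> is at least \<open>(Rt (Suc n))\<^sup>2\<close>. Both bounds now follow from
  \<open>0 \<le> R (Suc n) \<le> s (Suc n)\<close> and \<open>0 \<le> R n \<le> sqrt (E1 (\<phi> n) + C)\<close>.
\<close>

text \<open>The product is dominated by \<open>u\<^sup>2 + v\<^sup>2\<close>. Since a non-integrable
  function has integral 0 by convention, additivity of \<open>L2_inner\<close> rests on
  this.\<close>

lemma L2_integrable_mult:
  assumes "u \<in> L2_space \<Omega>" "v \<in> L2_space \<Omega>"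
  shows "integrable (lebesgue_on \<Omega>) (\<lambda>x. u x * v x)"
proof (rule Bochner_Integration.integrable_bound)
  show "integrable (lebesgue_on \<Omega>) (\<lambda>x. (u x)\<^sup>2 + (v x)\<^sup>2)"
    using assms by (auto simp: L2_space_def)
  show "(\<lambda>x. u x * v x) \<in> borel_measurable (lebesgue_on \<Omega>)"
    using assms by (auto simp: L2_space_def)
  have "\<bar>a * b\<bar> \<le> a\<^sup>2 + b\<^sup>2" for a b :: real
  proof -
    have "2 * (\<bar>a\<bar> * \<bar>b\<bar>) \<le> a\<^sup>2 + b\<^sup>2"
      using sum_squares_bound[of "\<bar>a\<bar>" "\<bar>b\<bar>"] by (simp add: mult.assoc)
    moreover have "0 \<le> \<bar>a\<bar> * \<bar>b\<bar>"
      by simp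
    ultimately show ?thesis
      unfolding abs_mult by linarith
  qed
  then show "AE x in lebesgue_on \<Omega>. norm (u x * v x) \<le> norm ((u x)\<^sup>2 + (v x)\<^sup>2)"
    by simp
qed

lemma L2_space_add:
  assumes "u \<in> L2_space \<Omega>" "v \<in> L2_space \<Omega>"
  shows "(\<lambda>x. u x + v x) \<in> L2_space \<Omega>"
proof -
  have "integrable (lebesgue_on \<Omega>) (\<lambda>x. (u x)\<^sup>2 + (v x)\<^sup>2 + 2 * (u x * v x))"
    using assms L2_integrable_mult[OF assms] by (auto simp: L2_space_def)
  then show ?thesis
    using assms by (auto simp: L2_space_def power2_sum mult.assoc)
qed

lemma L2_space_cmult:
  assumes "u \<in> L2_space \<Omega>"
  shows "(\<lambda>x. c * u x) \<in> L2_space \<Omega>"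
  using assms by (auto simp: L2_space_def power_mult_distrib)

lemma L2_space_diff:
  assumes "u \<in> L2_space \<Omega>" "v \<in> L2_space \<Omega>"
  shows "(\<lambda>x. u x - v x) \<in> L2_space \<Omega>"
  using L2_space_add[OF assms(1) L2_space_cmult[OF assms(2), of "- 1"]] by simp

lemma L2_inner_commute: "L2_inner \<Omega> u v = L2_inner \<Omega> v u"
  by (simp add: L2_inner_def mult.commute)

lemma L2_inner_add_left:
  assumes "u \<in> L2_space \<Omega>" "v \<in> L2_space \<Omega>" "w \<in> L2_space \<Omega>"
  shows "L2_inner \<Omega> (\<lambda>x. u x + v x) w = L2_inner \<Omega> u w + L2_inner \<Omega> v w"
  by (simp add: L2_inner_def distrib_right L2_integrable_mult assms)

lemma L2_inner_diff_left:
  assumes "u \<in> L2_space \<Omega>" "v \<in> L2_space \<Omega>" "w \<in> L2_space \<Omega>"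
  shows "L2_inner \<Omega> (\<lambda>x. u x - v x) w = L2_inner \<Omega> u w - L2_inner \<Omega> v w"
  by (simp add: L2_inner_def left_diff_distrib L2_integrable_mult assms)

lemma L2_inner_cmult_left: "L2_inner \<Omega> (\<lambda>x. c * u x) w = c * L2_inner \<Omega> u w"
  by (simp add: L2_inner_def mult.assoc)

text \<open>The equations of the scheme hold only almost everywhere; this carries them into inner
  products.\<close>

lemma L2_inner_cong_AE_left:
  assumes "u \<in> L2_space \<Omega>" "v \<in> L2_space \<Omega>" "w \<in> L2_space \<Omega>"
    and "AE x in lebesgue_on \<Omega>. u x = v x"
  shows "L2_inner \<Omega> u w = L2_inner \<Omega> v w"
  unfolding L2_inner_def
proof (rule integral_cong_AE)
  show "AE x in lebesgue_on \<Omega>. u x * w x = v x * w x"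
    using assms(4) by eventually_elim simp
qed (use assms in \<open>auto simp: L2_space_def\<close>)

text \<open>The new level carries \<open>Rt\<close> but the old one \<open>R\<close>, so these
  bounds do not chain over \<open>n\<close> by themselves; they serve to control the radicand in
  Step II.\<close>

lemma step_I_energy:
  assumes L: "linear_operator_L2 \<Omega> D_L L" "symmetric_L2 \<Omega> D_L L"
    and G: "linear_operator_L2 \<Omega> D_G G" "nonneg_L2 \<Omega> D_G G"
    and dt: "dt > 0"
    and phi: "\<phi> n \<in> D_L" "\<phi> (Suc n) \<in> D_L"
    and mu: "\<mu> n \<in> D_G"
    and hat: "(\<lambda>x. F' (phi_hat prev \<phi> n x)) \<in> L2_space \<Omega>"
    and step: "step_I \<Omega> L G F F' C dt prev \<phi> \<mu> Rt R n"
  shows "1/2 * L2_inner \<Omega> (L (\<phi> (Suc n))) (\<phi> (Suc n)) + (Rt (Suc n))\<^sup>2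
           \<le> 1/2 * L2_inner \<Omega> (L (\<phi> n)) (\<phi> n) + (R n)\<^sup>2"
proof -
  define f where "f = (\<lambda>x. F' (phi_hat prev \<phi> n x))"
  define q where "q = sqrt (E1_shifted \<Omega> F C (phi_hat prev \<phi> n))"
  define d where "d = (\<lambda>x. \<phi> (Suc n) x - \<phi> n x)"
  define l where "l = (\<lambda>x. L (\<phi> (Suc n)) x + L (\<phi> n) x)"
  define c where "c = (Rt (Suc n) + R n) / (2 * q)"
  have flow: "AE x in lebesgue_on \<Omega>. d x / dt = - G (\<mu> n) x"
    and pot: "AE x in lebesgue_on \<Omega>.
      \<mu> n x = 1/2 * L (\<phi> (Suc n)) x + 1/2 * L (\<phi> n) x + c * f x"
    and aux: "(Rt (Suc n) - R n) / dt = 1 / (2 * q) * L2_inner \<Omega> f (\<lambda>x. d x / dt)"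
    using step unfolding step_I_def Let_def f_def q_def d_def c_def by auto
  have L2: "\<phi> n \<in> L2_space \<Omega>" "\<phi> (Suc n) \<in> L2_space \<Omega>"
    "L (\<phi> n) \<in> L2_space \<Omega>" "L (\<phi> (Suc n)) \<in> L2_space \<Omega>"
    "\<mu> n \<in> L2_space \<Omega>" "G (\<mu> n) \<in> L2_space \<Omega>" "f \<in> L2_space \<Omega>"
    using L(1) G(1) phi mu hat unfolding linear_operator_L2_def f_def by auto
  have d: "d \<in> L2_space \<Omega>" and l: "l \<in> L2_space \<Omega>"
    unfolding d_def l_def by (simp_all add: L2 L2_space_diff L2_space_add)
  \<comment> \<open>First evaluation of the pairing of \<open>d\<close> with \<open>\<mu> n\<close>:
    the flow equation multiplied by \<open>dt\<close> gives its sign.\<close>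
  have "L2_inner \<Omega> d (\<mu> n) = L2_inner \<Omega> (\<lambda>x. - dt * G (\<mu> n) x) (\<mu> n)"
  proof (rule L2_inner_cong_AE_left)
    show "AE x in lebesgue_on \<Omega>. d x = - dt * G (\<mu> n) x"
      using flow by eventually_elim (use dt in \<open>simp add: field_simps\<close>)
  qed (simp_all only: L2 d L2_space_cmult)
  also have "\<dots> = - dt * L2_inner \<Omega> (G (\<mu> n)) (\<mu> n)"
    by (rule L2_inner_cmult_left)
  also have "\<dots> \<le> 0"
    using G(2) mu dt by (simp add: nonneg_L2_def)
  finally have dissipation: "L2_inner \<Omega> d (\<mu> n) \<le> 0" .
  \<comment> \<open>Second evaluation of the same pairing, now expanding \<open>\<mu> n\<close>;
    \<open>l\<close> is twice the average of the two \<open>L\<close> terms.\<close>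
  have "L2_inner \<Omega> (\<mu> n) d = L2_inner \<Omega> (\<lambda>x. 1/2 * l x + c * f x) d"
  proof (rule L2_inner_cong_AE_left)
    show "AE x in lebesgue_on \<Omega>. \<mu> n x = 1/2 * l x + c * f x"
      using pot by eventually_elim (simp add: l_def)
  qed (simp_all only: L2 d l L2_space_cmult L2_space_add)
  also have "\<dots> = 1/2 * L2_inner \<Omega> l d + c * L2_inner \<Omega> f d"
    by (simp only: L2_inner_add_left L2_inner_cmult_left L2_space_cmult L2 d l)
  also have "L2_inner \<Omega> l d = L2_inner \<Omega> (L (\<phi> (Suc n))) d + L2_inner \<Omega> (L (\<phi> n)) d"
    unfolding l_def by (rule L2_inner_add_left) (simp_all only: L2 d)
  \<comment> \<open>Expanding \<open>d\<close> leaves two mixed terms of opposite sign, which cancel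
    by symmetry of \<open>L\<close>.\<close>
  also have "\<dots> = L2_inner \<Omega> (L (\<phi> (Suc n))) (\<phi> (Suc n)) - L2_inner \<Omega> (L (\<phi> n)) (\<phi> n)"
  proof -
    have "L2_inner \<Omega> w d = L2_inner \<Omega> w (\<phi> (Suc n)) - L2_inner \<Omega> w (\<phi> n)"
      if "w \<in> L2_space \<Omega>" for w
      unfolding d_def using L2_inner_diff_left[OF L2(2,1) that]
      by (simp add: L2_inner_commute[of \<Omega> w])
    moreover have "L2_inner \<Omega> (L (\<phi> (Suc n))) (\<phi> n) = L2_inner \<Omega> (L (\<phi> n)) (\<phi> (Suc n))"
      using L(2) phi L2_inner_commute unfolding symmetric_L2_def by metis
    ultimately show ?thesis
      by (simp add: L2)
  qed
  \<comment> \<open>The factor \<open>1 / (2 * q)\<close> of \<open>c\<close> is moved onto the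
    inner product, where the third equation turns it into \<open>Rt (Suc n) - R n\<close>; a
    difference of squares remains.\<close>
  also have "c * L2_inner \<Omega> f d = (Rt (Suc n))\<^sup>2 - (R n)\<^sup>2"
  proof -
    have "L2_inner \<Omega> f (\<lambda>x. d x / dt) = L2_inner \<Omega> f d / dt"
      by (simp add: L2_inner_def)
    with aux have "(Rt (Suc n) - R n) / dt = (1 / (2 * q) * L2_inner \<Omega> f d) / dt"
      by simp
    with dt have "Rt (Suc n) - R n = 1 / (2 * q) * L2_inner \<Omega> f d"
      unfolding divide_cancel_right by simp
    then have "c * L2_inner \<Omega> f d = (Rt (Suc n) + R n) * (Rt (Suc n) - R n)"
      by (simp add: c_def)
    then show ?thesis
      by (simp add: power2_eq_square algebra_simps)
  qed
  finally show ?thesis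
    using dissipation unfolding L2_inner_commute[of \<Omega> d] by argo
qed

theorem theorem3p2:
  fixes \<Omega> :: "'a::euclidean_space set"
    and D_L D_G :: "('a \<Rightarrow> real) set"
    and L G :: "('a \<Rightarrow> real) \<Rightarrow> 'a \<Rightarrow> real"
    and F F' :: "real \<Rightarrow> real"
    and C dt :: real
    and \<phi>0 prev :: "'a \<Rightarrow> real"
    and \<phi> \<mu> :: "nat \<Rightarrow> 'a \<Rightarrow> real"
    and Rt R s :: "nat \<Rightarrow> real"
    and N :: nat
  assumes domain: "\<Omega> \<in> sets lebesgue"
    and L: "linear_operator_L2 \<Omega> D_L L" "symmetric_L2 \<Omega> D_L L" "nonneg_L2 \<Omega> D_L L"
    and G: "linear_operator_L2 \<Omega> D_G G" "nonneg_L2 \<Omega> D_G G"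
    and F: "\<And>r. (F has_real_derivative F' r) (at r)"
    and C: "C > 0"
    and bounded_below:
      "\<And>u. u \<in> L2_space \<Omega> \<Longrightarrow> integrable (lebesgue_on \<Omega>) (\<lambda>x. F (u x)) \<Longrightarrow> E1 \<Omega> F u > - C"
    and dt: "dt > 0"
    \<comment> \<open>regularity: all terms of the scheme and of the energies make sense\<close>
    and reg_prev: "prev \<in> L2_space \<Omega>"
    and reg_phi: "\<And>n. n \<le> N \<Longrightarrow> \<phi> n \<in> D_L"
      "\<And>n. n \<le> N \<Longrightarrow> integrable (lebesgue_on \<Omega>) (\<lambda>x. F (\<phi> n x))"
    and reg_mu: "\<And>n. n < N \<Longrightarrow> \<mu> n \<in> D_G"
    and reg_hat:
      "\<And>n. n < N \<Longrightarrow> integrable (lebesgue_on \<Omega>) (\<lambda>x. F (phi_hat prev \<phi> n x))"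
      "\<And>n. n < N \<Longrightarrow> (\<lambda>x. F' (phi_hat prev \<phi> n x)) \<in> L2_space \<Omega>"
    \<comment> \<open>the first N steps of the scheme\<close>
    and init: "\<phi> 0 = \<phi>0" "R 0 = sqrt (E1 \<Omega> F \<phi>0 + C)"
    and scheme:
      "\<And>n. n < N \<Longrightarrow> step_I \<Omega> L G F F' C dt prev \<phi> \<mu> Rt R n"
      "\<And>n. n < N \<Longrightarrow> step_II \<Omega> L F C \<phi> R s n"
  shows "\<forall>n<N.
      modified_energy \<Omega> L C (\<phi> (Suc n)) (R (Suc n)) - modified_energy \<Omega> L C (\<phi> n) (R n) \<le> 0 \<and>
      (s (Suc n) \<ge> sqrt (E1_shifted \<Omega> F C (\<phi> (Suc n))) \<longrightarrow>
        energy \<Omega> L F (\<phi> (Suc n)) \<le> energy \<Omega> L F (\<phi> n))"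
proof (intro allI impI)
  have E_pos: "0 < E1_shifted \<Omega> F C (\<phi> n)" if "n \<le> N" for n
  proof -
    have "\<phi> n \<in> L2_space \<Omega>"
      using reg_phi(1)[OF that] L(1) unfolding linear_operator_L2_def by blast
    from bounded_below[OF this reg_phi(2)[OF that]] show ?thesis
      by (simp add: E1_shifted_def)
  qed
  \<comment> \<open>\<open>sqrt\<close> is negative at negative arguments, so both the sign of
    \<open>s\<close> and the identity between \<open>(s (Suc n))\<^sup>2\<close> and the radicand
    depend on this.\<close>
  have rad_nonneg: "0 \<le> 1/2 * L2_inner \<Omega> (L (\<phi> n)) (\<phi> n)
      - 1/2 * L2_inner \<Omega> (L (\<phi> (Suc n))) (\<phi> (Suc n)) + (R n)\<^sup>2" if "n < N" for n
  proof -
    have "\<phi> n \<in> D_L" "\<phi> (Suc n) \<in> D_L"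
      using reg_phi(1) that by simp_all
    from step_I_energy[OF L(1,2) G dt this reg_mu[OF that] reg_hat(2)[OF that] scheme(1)[OF that]]
    show ?thesis
      using zero_le_power2[of "Rt (Suc n)"] by linarith
  qed
  have R_Suc: "0 \<le> R (Suc n)" "R (Suc n) \<le> s (Suc n)"
    "R (Suc n) \<le> sqrt (E1_shifted \<Omega> F C (\<phi> (Suc n)))" if "n < N" for n
    using scheme(2)[OF that] rad_nonneg[OF that] E_pos[of "Suc n"] that
    unfolding step_II_def by auto
  \<comment> \<open>At level 0 the initial value of \<open>R\<close> gives equality; at a positive
    level the bound comes from the minimum taken in the preceding step, hence \<open>n - 1\<close>
    below.\<close>
  have R_sq: "(R n)\<^sup>2 \<le> E1_shifted \<Omega> F C (\<phi> n)" if "n < N" for n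
  proof -
    have "0 \<le> R n" "R n \<le> sqrt (E1_shifted \<Omega> F C (\<phi> n))"
      using init(2) E_pos[of 0] R_Suc[of "n - 1"] that
      unfolding init(1)[symmetric] E1_shifted_def by (cases n; simp)+
    then have "(R n)\<^sup>2 \<le> (sqrt (E1_shifted \<Omega> F C (\<phi> n)))\<^sup>2"
      by (rule power_mono[rotated])
    then show ?thesis
      using E_pos[of n] that by simp
  qed
  fix n
  assume n: "n < N"
  have "(R (Suc n))\<^sup>2 \<le> (s (Suc n))\<^sup>2"
    using R_Suc[OF n] by (simp add: power_mono)
  also have "\<dots> = 1/2 * L2_inner \<Omega> (L (\<phi> n)) (\<phi> n)
      - 1/2 * L2_inner \<Omega> (L (\<phi> (Suc n))) (\<phi> (Suc n)) + (R n)\<^sup>2"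
    using scheme(2)[OF n] rad_nonneg[OF n] unfolding step_II_def by simp
  finally have stable: "(R (Suc n))\<^sup>2 \<le> \<dots>" .
  have "energy \<Omega> L F (\<phi> (Suc n)) \<le> energy \<Omega> L F (\<phi> n)"
    if "s (Suc n) \<ge> sqrt (E1_shifted \<Omega> F C (\<phi> (Suc n)))"
  proof -
    \<comment> \<open>Here the minimum selects the second argument, so \<open>R\<close> is exact at
      the new level. At the old level the one-sided bound \<open>R_sq\<close> points in the required
      direction, and \<open>C\<close> cancels.\<close>
    have "(R (Suc n))\<^sup>2 = E1_shifted \<Omega> F C (\<phi> (Suc n))"
      using scheme(2)[OF n] that E_pos[of "Suc n"] n unfolding step_II_def by simp
    with stable R_sq[OF n] show ?thesis
      unfolding energy_def E1_shifted_def by linarith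
  qed
  with stable show "modified_energy \<Omega> L C (\<phi> (Suc n)) (R (Suc n))
        - modified_energy \<Omega> L C (\<phi> n) (R n) \<le> 0 \<and>
      (s (Suc n) \<ge> sqrt (E1_shifted \<Omega> F C (\<phi> (Suc n))) \<longrightarrow>
        energy \<Omega> L F (\<phi> (Suc n)) \<le> energy \<Omega> L F (\<phi> n))"
    unfolding modified_energy_def by simp
qed

end
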